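(* Let $A$ be a finite set of alternatives with $n$-point imprecise evaluations on criteria $g_1,\dots,g_m$, let $\mathcal U$ be the set of compatible value functions, and let $\Delta,\Delta^{(i,k)},\succsim^N,\succsim^P,\succsim^N_{(i,k)},\succsim^P_{(i,k)}$ be the associated dominance, necessary and possible preference relations. All indices $i,k,i_1,k_1,r,s$ below range over $\{1,\dots,n\}$ and $a,b,c$ over $A$. Then: 1. For each $a$ and each $U\in\mathcal U$, if $i\ge k$ then $U(a^{(i)})\ge U(a^{(k)})$. 2. For each $a$ and each $U\in\mathcal U$, $U(a^{(1)})\le U(a)\le U(a^{(n)})$. 3. $\succsim^N\subseteq\succsim^P$. 4. For all $i,k$, $\succsim^N_{(i,k)}\subseteq\succsim^P_{(i,k)}$. 5. $\succsim^N$ is a partial preorder (reflexive and transitive). 6. $\succsim^P$ is strongly complete and negatively transitive. 7. For all $a,b$: $a\succsim^N b$ or $b\succsim^P a$. 8. $\Delta\subseteq\succsim^N$. 9. If $a\succsim^N b$ and $b\succsim^P c$, then $a\succsim^P c$. 10. If $a\succsim^P b$ and $b\succsim^N c$, then $a\succsim^P c$. 11. If $a\Delta b$ and $b\succsim^N c$, then $a\succsim^N c$. 12. If $a\succsim^N b$ and $b\Delta c$, then $a\succsim^N c$. 13. If $a\Delta b$ and $b\succsim^P c$, then $a\succsim^P c$. 14. If $a\succsim^P b$ and $b\Delta c$, then $a\succsim^P c$. 15. For all $i,k$, $\Delta^{(i,k)}\subseteq\succsim^N_{(i,k)}$. 16. If $a\succsim^N_{(i,n)}b$, $b\succsim^N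 c$ and $r\ge i$, then $a\succsim^N_{(r,1)}c$. 17. If $a\succsim^N b$, $b\succsim^N_{(1,k)}c$ and $r\le k$, then $a\succsim^N_{(n,r)}c$. 18. If $a\succsim^P_{(i,n)}b$, $b\succsim^N c$ and $r\ge i$, then $a\succsim^P_{(r,1)}c$. 19. If $a\succsim^N b$, $b\succsim^P_{(1,k)}c$ and $r\le k$, then $a\succsim^P_{(n,r)}c$. 20. If $a\succsim^N_{(i,n)}b$, $b\succsim^P c$ and $r\ge i$, then $a\succsim^P_{(r,1)}c$. 21. If $a\succsim^P b$, $b\succsim^N_{(1,k)}c$ and $r\le k$, then $a\succsim^P_{(n,r)}c$. 22. If $a\Delta^{(i,n)}b$, $b\succsim^N c$ and $r\ge i$, then $a\succsim^N_{(r,1)}c$. 23. If $a\succsim^N b$, $b\Delta^{(1,k)}c$ and $r\le k$, then $a\succsim^N_{(n,r)}c$. 24. If $a\Delta^{(i,n)}b$, $b\succsim^P c$ and $r\ge i$, then $a\succsim^P_{(r,1)}c$. 25. If $a\succsim^P b$, $b\Delta^{(1,k)}c$ and $r\le k$, then $a\succsim^P_{(n,r)}c$. 26. If $a\Delta b$, $b\succsim^N_{(1,k)}c$ and $r\le k$, then $a\succsim^N_{(n,r)}c$. 27. If $a\succsim^N_{(i,n)}b$, $b\Delta c$ and $r\ge i$, then $a\succsim^N_{(r,1)}c$. 28. If $a\Delta b$, $b\succsim^P_{(1,k)}c$ and $r\le k$, then $a\succsim^P_{(n,r)}c$. 29. If $a\succsim^P_{(i,n)}b$, $b\Delta c$ and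 $r\ge i$, then $a\succsim^P_{(r,1)}c$. 30. If $i\ge k$, then $\succsim^N_{(i,k)}$ is reflexive. 31. If $i\le k$, then $\succsim^N_{(i,k)}$ is transitive. 32. For each $i$, $\succsim^N_{(i,i)}$ is a partial preorder. 33. For all $a,b$ and all $i,k$: $a\succsim^N_{(i,k)}b$ or $b\succsim^P_{(k,i)}a$. 34. If $i\ge k$, then $\succsim^P_{(i,k)}$ is strongly complete and negatively transitive. 35. If $i_1\ge i$ and $k_1\le k$, then $\succsim^N_{(i,k)}\subseteq\succsim^N_{(i_1,k_1)}$. 36. If $i_1\ge i$ and $k_1\le k$, then $\succsim^P_{(i,k)}\subseteq\succsim^P_{(i_1,k_1)}$. 37. For all $i,k$, $\succsim^N_{(1,n)}\subseteq\succsim^N_{(i,k)}\subseteq\succsim^N_{(n,1)}$. 38. For all $i,k$, $\succsim^P_{(1,n)}\subseteq\succsim^P_{(i,k)}\subseteq\succsim^P_{(n,1)}$. 39. $\succsim^N_{(1,n)}\subseteq\succsim^N\subseteq\succsim^N_{(n,1)}$. 40. $\succsim^P_{(1,n)}\subseteq\succsim^P\subseteq\succsim^P_{(n,1)}$. In items 41–47, assume $k\ge i_1$, $r\ge i$ and $s\le k_1$: 41. If $a\succsim^N_{(i,k)}b$ and $b\succsim^N_{(i_1,k_1)}c$, then $a\succsim^N_{(r,s)}c$. 42. If $a\succsim^N_{(i,k)}b$ and $b\succsim^P_{(i_1,k_1)}c$, then $a\succsim^P_{(r,s)}c$. 43. If $a\succsim^P_{(i,k)}b$ and $b\succsim^N_{(i_1,k_1)}c$,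 then $a\succsim^P_{(r,s)}c$. 44. If $a\Delta^{(i,k)}b$ and $b\succsim^N_{(i_1,k_1)}c$, then $a\succsim^N_{(r,s)}c$. 45. If $a\succsim^N_{(i,k)}b$ and $b\Delta^{(i_1,k_1)}c$, then $a\succsim^N_{(r,s)}c$. 46. If $a\Delta^{(i,k)}b$ and $b\succsim^P_{(i_1,k_1)}c$, then $a\succsim^P_{(r,s)}c$. 47. If $a\succsim^P_{(i,k)}b$ and $b\Delta^{(i_1,k_1)}c$, then $a\succsim^P_{(r,s)}c$.
   Context: Evaluations. $A$ is a finite set of alternatives, $J=\{1,\dots,m\}$ indexes the criteria, $n\ge1$ is an integer. Each criterion $g_j$, $j\in J$, assigns to each $a\in A$ an $n$-point evaluation $g_j(a)=[g_j^1(a),\dots,g_j^n(a)]$ of real numbers with $g_j^1(a)\le\dots\le g_j^n(a)$. Dominance. $a\Delta^{(i,k)}b$ iff $g_j^i(a)\ge g_j^k(b)$ for all $j\in J$; $a\Delta b$ iff $g_j^i(a)\ge g_j^i(b)$ for all $j\in J$ and all $i\in\{1,\dots,n\}$. Value functions. For $j\in J$, let $X_j(A)=\{g_j^i(a):a\in A,\ i=1,\dots,n\}=\{x_j^1<x_j^2<\dots<x_j^{m_j(A)}\}$. A value function $U$ is given by sub-marginal value functions $u_{j,i}:X_j(A)\to\mathbb R$ ($j\in J$, $i=1,\dots,n$), with $U_j(a)=\sum_{i=1}^n u_{j,i}(g_j^i(a))$ and $U(a)=\sum_{j=1}^m U_j(a)$. For $a\in A$ and $i\in\{1,\dots,n\}$,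 the fictitious alternative $a^{(i)}$ has all indicators on criterion $g_j$ equal to $g_j^i(a)$, so $U(a^{(i)})=\sum_{j=1}^m\sum_{r=1}^n u_{j,r}(g_j^i(a))$. Preference information. On a set $A^R\subseteq A$ of reference alternatives the decision maker provides partial preorders $\succsim$ and $\succsim_j$ ($j\in J$) on $A^R$, and $\succsim^*$ and $\succsim^*_j$ ($j\in J$) on $A^R\times A^R$; $\succ,\sim$ (with the same decorations) denote their asymmetric and symmetric parts. Compatibility. $U$ is compatible if: (i) for all $\bar a,\bar b,\bar c,\bar d\in A^R$ and $j\in J$: $U(\bar a)>U(\bar b)$ if $\bar a\succ\bar b$; $U(\bar a)=U(\bar b)$ if $\bar a\sim\bar b$; $U(\bar a)-U(\bar b)>U(\bar c)-U(\bar d)$ if $(\bar a,\bar b)\succ^*(\bar c,\bar d)$; $U(\bar a)-U(\bar b)=U(\bar c)-U(\bar d)$ if $(\bar a,\bar b)\sim^*(\bar c,\bar d)$; and the same four conditions with $U_j,\succ_j,\sim_j,\succ_j^*,\sim_j^*$ in place of $U,\succ,\sim,\succ^*,\sim^*$; (ii) $u_{j,i}(x_j^k)\ge u_{j,i}(x_j^{k-1})$ for all $j\in J$, $i=1,\dots,n$, $k=2,\dots,m_j(A)$; (iii) $u_{j,i}(x_j^1)=0$ for all $j,i$; (iv) $\sum_{j\in J}\sum_{i=1}^n u_{j,i}(x_j^{m_j(A)})=1$. $\mathcal U$ is the set of all compatible value functions; it is assumed to contain more than one element (in particular it is non-empty). Preference relations. For $a,b\in A$, $i,k\in\{1,\dots,n\}$: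 $a\succsim^N b$ iff $U(a)\ge U(b)$ for all $U\in\mathcal U$; $a\succsim^P b$ iff $U(a)\ge U(b)$ for some $U\in\mathcal U$; $a\succsim^N_{(i,k)}b$ iff $U(a^{(i)})\ge U(b^{(k)})$ for all $U\in\mathcal U$; $a\succsim^P_{(i,k)}b$ iff $U(a^{(i)})\ge U(b^{(k)})$ for some $U\in\mathcal U$. Terminology. A relation $R$ on $A$ is strongly complete if for all $a,b\in A$, $aRb$ or $bRa$; negatively transitive if (not $aRb$ and not $bRc$) implies not $aRc$. A partial preorder is a reflexive and transitive relation. Inclusions are between subsets of $A\times A$. *)

theory Defs
  imports Complex_Main "HOL-Library.FuncSet"
begin

text \<open>
  Criteria are indexed by \<open>{1..num_criteria}\<close> and indicators by \<open>{1..num_points}\<close>.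
  \<open>evaluation a j i\<close> is the \<open>i\<close>-th indicator of \<open>a\<close> on criterion \<open>j\<close>.
  The four preference relations are, in this order, the comprehensive one and the one per
  criterion on reference alternatives, and the comprehensive one and the one per criterion on
  pairs of reference alternatives (intensity of preference).
\<close>
record 'a problem =
  alternatives :: "'a set"
  num_criteria :: nat
  num_points :: nat
  evaluation :: "'a \<Rightarrow> nat \<Rightarrow> nat \<Rightarrow> real"
  references :: "'a set"
  pref :: "'a rel"
  pref_on :: "nat \<Rightarrow> 'a rel"
  intensity :: "('a \<times> 'a) rel"
  intensity_on :: "nat \<Rightarrow> ('a \<times> 'a) rel"

abbreviation criteria :: "'a problem \<Rightarrow> nat set" where
  "criteria M \<equiv> {1..num_criteria M}"

abbreviation indicators :: "'a problem \<Rightarrow> nat set" where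
  "indicators M \<equiv> {1..num_points M}"

definition valid_problem :: "'a problem \<Rightarrow> bool" where
  "valid_problem M \<longleftrightarrow>
     finite (alternatives M) \<and>
     num_points M \<ge> 1 \<and>
     (\<forall>a\<in>alternatives M. \<forall>j\<in>criteria M. mono_on (indicators M) (evaluation M a j)) \<and>
     references M \<subseteq> alternatives M \<and>
     preorder_on (references M) (pref M) \<and>
     (\<forall>j\<in>criteria M. preorder_on (references M) (pref_on M j)) \<and>
     preorder_on (references M \<times> references M) (intensity M) \<and>
     (\<forall>j\<in>criteria M. preorder_on (references M \<times> references M) (intensity_on M j))"

definition dominance :: "'a problem \<Rightarrow> 'a rel" where
  "dominance M = {(a, b) \<in> alternatives M \<times> alternatives M.
     \<forall>j\<in>criteria M. \<forall>i\<in>indicators M. evaluation M a j i \<ge> evaluation M b j i}"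

definition dominance_at :: "'a problem \<Rightarrow> nat \<Rightarrow> nat \<Rightarrow> 'a rel" where
  "dominance_at M i k = {(a, b) \<in> alternatives M \<times> alternatives M.
     \<forall>j\<in>criteria M. evaluation M a j i \<ge> evaluation M b j k}"

definition levels :: "'a problem \<Rightarrow> nat \<Rightarrow> real set" where
  "levels M j = {evaluation M a j i | a i. a \<in> alternatives M \<and> i \<in> indicators M}"

definition num_levels :: "'a problem \<Rightarrow> nat \<Rightarrow> nat" where
  "num_levels M j = card (levels M j)"

text \<open>\<open>level M j k\<close> is the \<open>k\<close>-th smallest element of \<open>levels M j\<close>, counted from 1.\<close>
definition level :: "'a problem \<Rightarrow> nat \<Rightarrow> nat \<Rightarrow> real" where
  "level M j k = sorted_list_of_set (levels M j) ! (k - 1)"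

text \<open>
  A value function is the family \<open>u\<close> of its sub-marginal value functions, \<open>u j i\<close> being defined
  on \<open>levels M j\<close>. The extensional function space makes two families equal as soon as they agree
  on all \<open>j\<close>, \<open>i\<close> and levels, so that counting compatible value functions is meaningful.
\<close>
type_synonym value_fun = "nat \<Rightarrow> nat \<Rightarrow> real \<Rightarrow> real"

definition value_functions :: "'a problem \<Rightarrow> value_fun set" where
  "value_functions M =
     (\<Pi>\<^sub>E j\<in>criteria M. \<Pi>\<^sub>E i\<in>indicators M. levels M j \<rightarrow>\<^sub>E UNIV)"

text \<open>
  Values are attached to evaluation profiles (criterion, indicator), so that they also apply to
  fictitious alternatives, which need not belong to \<open>alternatives M\<close>.
\<close>
definition marginal_of ::
    "'a problem \<Rightarrow> value_fun \<Rightarrow> nat \<Rightarrow> (nat \<Rightarrow> nat \<Rightarrow> real) \<Rightarrow> real" where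
  "marginal_of M u j p = (\<Sum>i\<in>indicators M. u j i (p j i))"

definition total_of :: "'a problem \<Rightarrow> value_fun \<Rightarrow> (nat \<Rightarrow> nat \<Rightarrow> real) \<Rightarrow> real" where
  "total_of M u p = (\<Sum>j\<in>criteria M. marginal_of M u j p)"

definition fictitious :: "'a problem \<Rightarrow> 'a \<Rightarrow> nat \<Rightarrow> (nat \<Rightarrow> nat \<Rightarrow> real)" where
  "fictitious M a i = (\<lambda>j r. evaluation M a j i)"

definition marginal_val :: "'a problem \<Rightarrow> value_fun \<Rightarrow> nat \<Rightarrow> 'a \<Rightarrow> real" where
  "marginal_val M u j a = marginal_of M u j (evaluation M a)"

definition val :: "'a problem \<Rightarrow> value_fun \<Rightarrow> 'a \<Rightarrow> real" where
  "val M u a = total_of M u (evaluation M a)"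

definition val_at :: "'a problem \<Rightarrow> value_fun \<Rightarrow> 'a \<Rightarrow> nat \<Rightarrow> real" where
  "val_at M u a i = total_of M u (fictitious M a i)"

definition asym_part :: "'b rel \<Rightarrow> 'b rel" where
  "asym_part R = {(x, y). (x, y) \<in> R \<and> (y, x) \<notin> R}"

definition sym_part :: "'b rel \<Rightarrow> 'b rel" where
  "sym_part R = {(x, y). (x, y) \<in> R \<and> (y, x) \<in> R}"

definition restores :: "'a set \<Rightarrow> ('a \<Rightarrow> real) \<Rightarrow> 'a rel \<Rightarrow> ('a \<times> 'a) rel \<Rightarrow> bool" where
  "restores S V R Q \<longleftrightarrow>
     (\<forall>a\<in>S. \<forall>b\<in>S. \<forall>c\<in>S. \<forall>d\<in>S.
        ((a, b) \<in> asym_part R \<longrightarrow> V a > V b) \<and>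
        ((a, b) \<in> sym_part R \<longrightarrow> V a = V b) \<and>
        (((a, b), (c, d)) \<in> asym_part Q \<longrightarrow> V a - V b > V c - V d) \<and>
        (((a, b), (c, d)) \<in> sym_part Q \<longrightarrow> V a - V b = V c - V d))"

definition compatible :: "'a problem \<Rightarrow> value_fun set" where
  "compatible M = {u \<in> value_functions M.
     restores (references M) (val M u) (pref M) (intensity M) \<and>
     (\<forall>j\<in>criteria M.
        restores (references M) (marginal_val M u j) (pref_on M j) (intensity_on M j)) \<and>
     (\<forall>j\<in>criteria M. \<forall>i\<in>indicators M. \<forall>k\<in>{2..num_levels M j}.
        u j i (level M j k) \<ge> u j i (level M j (k - 1))) \<and>
     (\<forall>j\<in>criteria M. \<forall>i\<in>indicators M. u j i (level M j 1) = 0) \<and>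
     (\<Sum>j\<in>criteria M. \<Sum>i\<in>indicators M. u j i (level M j (num_levels M j))) = 1}"

definition necessary :: "'a problem \<Rightarrow> 'a rel" where
  "necessary M = {(a, b) \<in> alternatives M \<times> alternatives M.
     \<forall>u\<in>compatible M. val M u a \<ge> val M u b}"

definition possible :: "'a problem \<Rightarrow> 'a rel" where
  "possible M = {(a, b) \<in> alternatives M \<times> alternatives M.
     \<exists>u\<in>compatible M. val M u a \<ge> val M u b}"

definition necessary_at :: "'a problem \<Rightarrow> nat \<Rightarrow> nat \<Rightarrow> 'a rel" where
  "necessary_at M i k = {(a, b) \<in> alternatives M \<times> alternatives M.
     \<forall>u\<in>compatible M. val_at M u a i \<ge> val_at M u b k}"

definition possible_at :: "'a problem \<Rightarrow> nat \<Rightarrow> nat \<Rightarrow> 'a rel" where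
  "possible_at M i k = {(a, b) \<in> alternatives M \<times> alternatives M.
     \<exists>u\<in>compatible M. val_at M u a i \<ge> val_at M u b k}"

definition strongly_complete_on :: "'b set \<Rightarrow> 'b rel \<Rightarrow> bool" where
  "strongly_complete_on S R \<longleftrightarrow> (\<forall>a\<in>S. \<forall>b\<in>S. (a, b) \<in> R \<or> (b, a) \<in> R)"

definition negatively_transitive_on :: "'b set \<Rightarrow> 'b rel \<Rightarrow> bool" where
  "negatively_transitive_on S R \<longleftrightarrow>
     (\<forall>a\<in>S. \<forall>b\<in>S. \<forall>c\<in>S. (a, b) \<notin> R \<and> (b, c) \<notin> R \<longrightarrow> (a, c) \<notin> R)"

end

theory Submission
  imports Defs
begin

text \<open>
  Every relation in the statement compares two evaluation profiles, where an alternative \<open>a\<close>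
  contributes its own profile \<open>evaluation M a\<close> and the fictitious profiles \<open>fictitious M a i\<close>.
  On profiles there are only three relations: \<open>p\<close> dominates \<open>q\<close>, \<open>p\<close> is necessarily at least as
  good as \<open>q\<close> (for all compatible value functions), and \<open>p\<close> is possibly at least as good as \<open>q\<close>
  (for some). Since each value function orders the profiles by real numbers, the necessary
  relation is a preorder, a possible comparison may be extended by a necessary one at either
  end, and where a possible comparison fails the reverse one is necessary
  (\<open>nec_pref_trans\<close>, \<open>nec_pos_trans\<close>, \<open>pos_nec_trans\<close>, \<open>not_pos_pref_imp_nec_pref\<close>).
  Necessary comparisons are possible because there is a compatible value function.

  The evaluations enter through one fact, \<open>dominates_imp_nec_pref\<close>: sub-marginal value
  functions are monotone on the levels, so dominance implies necessary preference. As
  the indicators of an alternative are ordered, \<open>a\<^sup>(\<^sup>i\<^sup>)\<close> dominates \<open>a\<^sup>(\<^sup>k\<^sup>)\<close> for \<open>i \<ge> k\<close>, and \<open>a\<close> lies between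
  \<open>a\<^sup>(\<^sup>1\<^sup>)\<close> and \<open>a\<^sup>(\<^sup>n\<^sup>)\<close>. Each of the mixed transitivity laws is then a chain of comparisons
  such as \<open>a\<^sup>(\<^sup>r\<^sup>) \<ge> a\<^sup>(\<^sup>i\<^sup>) \<ge> b\<^sup>(\<^sup>n\<^sup>) \<ge> b \<ge> c \<ge> c\<^sup>(\<^sup>1\<^sup>)\<close> in which at most one link is merely
  possible.
\<close>

section \<open>Monotonicity of sub-marginal value functions\<close>

lemma finite_levels:
  assumes "valid_problem M"
  shows "finite (levels M j)"
proof -
  have "levels M j = (\<Union>a\<in>alternatives M. evaluation M a j ` indicators M)"
    unfolding levels_def by blast
  then show ?thesis
    using assms by (simp add: valid_problem_def)
qed

text \<open>
  Compatibility only compares consecutive levels; an arbitrary level is \<open>level M j k\<close> for some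
  \<open>k\<close>, so the comparison propagates along the sorted list of levels.
\<close>
lemma compatible_mono_on_levels:
  assumes "valid_problem M" "u \<in> compatible M" "j \<in> criteria M" "i \<in> indicators M"
  shows "mono_on (levels M j) (u j i)"
proof (rule mono_onI)
  fix x y
  assume x: "x \<in> levels M j" and y: "y \<in> levels M j" and "x \<le> y"
  define xs where "xs = sorted_list_of_set (levels M j)"
  have xs: "set xs = levels M j" "sorted_wrt (<) xs" "length xs = num_levels M j"
    using finite_levels[OF assms(1)] by (simp_all add: xs_def num_levels_def)
  obtain s t where s: "s < length xs" "x = xs ! s" and t: "t < length xs" "y = xs ! t"
    using x y xs(1) by (metis in_set_conv_nth)
  have "s \<le> t"
    using \<open>x \<le> y\<close> s t sorted_wrt_nth_less[OF xs(2), of t s] by fastforce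
  have consecutive: "u j i (xs ! k) \<le> u j i (xs ! Suc k)" if "Suc k < length xs" for k
  proof -
    have "\<forall>k\<in>{2..num_levels M j}. u j i (level M j (k - 1)) \<le> u j i (level M j k)"
      using assms(2-4) by (simp add: compatible_def)
    \<comment> \<open>\<open>level\<close> counts from 1, list positions from 0.\<close>
    from bspec[OF this, of "Suc (Suc k)"] show ?thesis
      using that xs(3) by (simp add: level_def xs_def)
  qed
  from \<open>s \<le> t\<close> \<open>t < length xs\<close> have "u j i (xs ! s) \<le> u j i (xs ! t)"
  proof (induction t rule: dec_induct)
    case (step t)
    then show ?case
      using consecutive[of t] by simp
  qed simp
  then show "u j i x \<le> u j i y"
    using s t by simp
qed

section \<open>Preference and dominance between evaluation profiles\<close>

definition nec_pref ::
    "'a problem \<Rightarrow> (nat \<Rightarrow> nat \<Rightarrow> real) \<Rightarrow> (nat \<Rightarrow> nat \<Rightarrow> real) \<Rightarrow> bool" where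
  "nec_pref M p q \<longleftrightarrow> (\<forall>u\<in>compatible M. total_of M u p \<ge> total_of M u q)"

definition pos_pref ::
    "'a problem \<Rightarrow> (nat \<Rightarrow> nat \<Rightarrow> real) \<Rightarrow> (nat \<Rightarrow> nat \<Rightarrow> real) \<Rightarrow> bool" where
  "pos_pref M p q \<longleftrightarrow> (\<exists>u\<in>compatible M. total_of M u p \<ge> total_of M u q)"

text \<open>
  Profiles are restricted to levels because sub-marginal value functions are
  unspecified elsewhere.
\<close>
definition dominates ::
    "'a problem \<Rightarrow> (nat \<Rightarrow> nat \<Rightarrow> real) \<Rightarrow> (nat \<Rightarrow> nat \<Rightarrow> real) \<Rightarrow> bool" where
  "dominates M p q \<longleftrightarrow>
     (\<forall>j\<in>criteria M. \<forall>i\<in>indicators M.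
        p j i \<in> levels M j \<and> q j i \<in> levels M j \<and> p j i \<ge> q j i)"

lemma nec_pref_refl: "nec_pref M p p"
  by (simp add: nec_pref_def)

lemma nec_pref_trans: "nec_pref M p q \<Longrightarrow> nec_pref M q r \<Longrightarrow> nec_pref M p r"
  unfolding nec_pref_def by (meson order_trans)

lemma nec_pos_trans: "nec_pref M p q \<Longrightarrow> pos_pref M q r \<Longrightarrow> pos_pref M p r"
  unfolding nec_pref_def pos_pref_def by (meson order_trans)

lemma pos_nec_trans: "pos_pref M p q \<Longrightarrow> nec_pref M q r \<Longrightarrow> pos_pref M p r"
  unfolding nec_pref_def pos_pref_def by (meson order_trans)

lemma not_nec_pref_imp_pos_pref: "\<not> nec_pref M p q \<Longrightarrow> pos_pref M q p"
  unfolding nec_pref_def pos_pref_def by (meson linear)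

lemma not_pos_pref_imp_nec_pref: "\<not> pos_pref M p q \<Longrightarrow> nec_pref M q p"
  unfolding nec_pref_def pos_pref_def by (meson linear)

lemma nec_pref_imp_pos_pref:
  assumes "compatible M \<noteq> {}"
  shows "nec_pref M p q \<Longrightarrow> pos_pref M p q"
  using assms unfolding nec_pref_def pos_pref_def by blast

lemma dominates_imp_nec_pref:
  assumes "valid_problem M" "dominates M p q"
  shows "nec_pref M p q"
  unfolding nec_pref_def total_of_def marginal_of_def
proof (intro ballI sum_mono)
  fix u j i
  assume "u \<in> compatible M" and ji: "j \<in> criteria M" "i \<in> indicators M"
  with assms(1) have "mono_on (levels M j) (u j i)"
    by (rule compatible_mono_on_levels)
  with assms(2) ji show "u j i (q j i) \<le> u j i (p j i)"
    unfolding dominates_def by (blast dest: mono_onD)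
qed

section \<open>Alternatives and their fictitious companions\<close>

lemma evaluation_in_levels:
  "a \<in> alternatives M \<Longrightarrow> i \<in> indicators M \<Longrightarrow> evaluation M a j i \<in> levels M j"
  unfolding levels_def by blast

lemma evaluation_mono:
  assumes "valid_problem M" "a \<in> alternatives M" "j \<in> criteria M"
    and "k \<in> indicators M" "i \<in> indicators M" "k \<le> i"
  shows "evaluation M a j k \<le> evaluation M a j i"
  using assms unfolding valid_problem_def by (blast dest: mono_onD)

lemma fictitious_mono:
  assumes "valid_problem M" "a \<in> alternatives M"
    and "k \<in> indicators M" "i \<in> indicators M" "k \<le> i"
  shows "nec_pref M (fictitious M a i) (fictitious M a k)"
  using assms evaluation_mono[OF assms(1,2)] evaluation_in_levels[OF assms(2)]
  by (intro dominates_imp_nec_pref) (simp_all add: dominates_def fictitious_def)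

lemma fictitious_first_le:
  assumes "valid_problem M" "a \<in> alternatives M"
  shows "nec_pref M (evaluation M a) (fictitious M a 1)"
  using assms evaluation_mono[OF assms, of _ 1] evaluation_in_levels[OF assms(2)]
  by (intro dominates_imp_nec_pref) (auto simp: dominates_def fictitious_def)

lemma fictitious_last_ge:
  assumes "valid_problem M" "a \<in> alternatives M"
  shows "nec_pref M (fictitious M a (num_points M)) (evaluation M a)"
  using assms evaluation_mono[OF assms, of _ _ "num_points M"] evaluation_in_levels[OF assms(2)]
  by (intro dominates_imp_nec_pref) (auto simp: dominates_def fictitious_def)

lemma necessary_iff:
  "(a, b) \<in> necessary M \<longleftrightarrow> a \<in> alternatives M \<and> b \<in> alternatives M \<and>
     nec_pref M (evaluation M a) (evaluation M b)"
  by (simp add: necessary_def nec_pref_def val_def)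

lemma possible_iff:
  "(a, b) \<in> possible M \<longleftrightarrow> a \<in> alternatives M \<and> b \<in> alternatives M \<and>
     pos_pref M (evaluation M a) (evaluation M b)"
  by (simp add: possible_def pos_pref_def val_def)

lemma necessary_at_iff:
  "(a, b) \<in> necessary_at M i k \<longleftrightarrow> a \<in> alternatives M \<and> b \<in> alternatives M \<and>
     nec_pref M (fictitious M a i) (fictitious M b k)"
  by (simp add: necessary_at_def nec_pref_def val_at_def)

lemma possible_at_iff:
  "(a, b) \<in> possible_at M i k \<longleftrightarrow> a \<in> alternatives M \<and> b \<in> alternatives M \<and>
     pos_pref M (fictitious M a i) (fictitious M b k)"
  by (simp add: possible_at_def pos_pref_def val_at_def)

lemma dominance_subset_necessary:
  assumes "valid_problem M"
  shows "dominance M \<subseteq> necessary M"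
  by (auto simp: dominance_def necessary_iff dominates_def evaluation_in_levels
      intro!: dominates_imp_nec_pref[OF assms])

lemma dominance_at_subset_necessary_at:
  assumes "valid_problem M" "i \<in> indicators M" "k \<in> indicators M"
  shows "dominance_at M i k \<subseteq> necessary_at M i k"
  using assms(2,3)
  by (auto simp: dominance_at_def necessary_at_iff dominates_def fictitious_def evaluation_in_levels
      intro!: dominates_imp_nec_pref[OF assms(1)])

text \<open>
  The two indicators move in opposite directions because \<open>a\<^sup>(\<^sup>i\<^sup>)\<close> improves with \<open>i\<close>, which helps
  on the left and hurts on the right.
\<close>

lemma necessary_at_weaken:
  assumes "valid_problem M" "(a, b) \<in> necessary_at M i k" "i \<le> r" "s \<le> k"
    and "i \<in> indicators M" "k \<in> indicators M" "r \<in> indicators M" "s \<in> indicators M"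
  shows "(a, b) \<in> necessary_at M r s"
  using assms unfolding necessary_at_iff by (blast intro: fictitious_mono nec_pref_trans)

lemma possible_at_weaken:
  assumes "valid_problem M" "(a, b) \<in> possible_at M i k" "i \<le> r" "s \<le> k"
    and "i \<in> indicators M" "k \<in> indicators M" "r \<in> indicators M" "s \<in> indicators M"
  shows "(a, b) \<in> possible_at M r s"
  using assms unfolding possible_at_iff
  by (blast intro: fictitious_mono nec_pos_trans pos_nec_trans)

text \<open>
  The two comparisons mention \<open>b\<close> at different indicators; as \<open>i1 \<le> k\<close>, the necessary
  preference of \<open>b\<^sup>(\<^sup>k\<^sup>)\<close> over \<open>b\<^sup>(\<^sup>i\<^sup>1\<^sup>)\<close> bridges them. The bridge being necessary, a possible link
  on either side survives.
\<close>

lemma necessary_at_trans: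
  assumes "valid_problem M" "(a, b) \<in> necessary_at M i k" "(b, c) \<in> necessary_at M i1 k1" "i1 \<le> k"
    and "k \<in> indicators M" "i1 \<in> indicators M"
  shows "(a, c) \<in> necessary_at M i k1"
  using assms unfolding necessary_at_iff
  by (blast intro: fictitious_mono nec_pref_trans)

lemma necessary_possible_at_trans:
  assumes "valid_problem M" "(a, b) \<in> necessary_at M i k" "(b, c) \<in> possible_at M i1 k1" "i1 \<le> k"
    and "k \<in> indicators M" "i1 \<in> indicators M"
  shows "(a, c) \<in> possible_at M i k1"
  using assms unfolding necessary_at_iff possible_at_iff
  by (blast intro: fictitious_mono nec_pos_trans)

lemma possible_necessary_at_trans:
  assumes "valid_problem M" "(a, b) \<in> possible_at M i k" "(b, c) \<in> necessary_at M i1 k1" "i1 \<le> k"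
    and "k \<in> indicators M" "i1 \<in> indicators M"
  shows "(a, c) \<in> possible_at M i k1"
  using assms unfolding necessary_at_iff possible_at_iff
  by (blast intro: fictitious_mono pos_nec_trans)

lemma necessary_subset_necessary_at:
  assumes "valid_problem M"
  shows "necessary M \<subseteq> necessary_at M (num_points M) 1"
  using assms
  by (auto simp only: necessary_iff necessary_at_iff)
    (meson fictitious_first_le fictitious_last_ge nec_pref_trans)

lemma necessary_at_subset_necessary:
  assumes "valid_problem M"
  shows "necessary_at M 1 (num_points M) \<subseteq> necessary M"
  using assms
  by (auto simp only: necessary_iff necessary_at_iff)
    (meson fictitious_first_le fictitious_last_ge nec_pref_trans)

lemma possible_subset_possible_at:
  assumes "valid_problem M"
  shows "possible M \<subseteq> possible_at M (num_points M) 1"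
  using assms
  by (auto simp only: possible_iff possible_at_iff)
    (meson fictitious_first_le fictitious_last_ge nec_pos_trans pos_nec_trans)

lemma possible_at_subset_possible:
  assumes "valid_problem M"
  shows "possible_at M 1 (num_points M) \<subseteq> possible M"
  using assms
  by (auto simp only: possible_iff possible_at_iff)
    (meson fictitious_first_le fictitious_last_ge nec_pos_trans pos_nec_trans)

text \<open>
  If \<open>b\<^sup>(\<^sup>i\<^sup>) \<ge> a\<^sup>(\<^sup>k\<^sup>)\<close> is impossible, then \<open>a\<^sup>(\<^sup>k\<^sup>) \<ge> b\<^sup>(\<^sup>i\<^sup>)\<close> is necessary, and \<open>k \<le> i\<close> lets both sides
  move towards \<open>a\<^sup>(\<^sup>i\<^sup>) \<ge> b\<^sup>(\<^sup>k\<^sup>)\<close>.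
\<close>
lemma possible_at_strongly_complete:
  assumes "valid_problem M" "compatible M \<noteq> {}" "i \<in> indicators M" "k \<in> indicators M" "k \<le> i"
  shows "strongly_complete_on (alternatives M) (possible_at M i k)"
  unfolding strongly_complete_on_def
proof (intro ballI disjCI)
  fix a b
  assume ab: "a \<in> alternatives M" "b \<in> alternatives M" "(b, a) \<notin> possible_at M i k"
  then have "nec_pref M (fictitious M a k) (fictitious M b i)"
    unfolding possible_at_iff by (blast intro: not_pos_pref_imp_nec_pref)
  then have "(a, b) \<in> necessary_at M k i"
    using ab by (simp only: necessary_at_iff)
  then have "(a, b) \<in> necessary_at M i k"
    using assms by (blast intro: necessary_at_weaken)
  then show "(a, b) \<in> possible_at M i k"
    using assms(2) unfolding necessary_at_iff possible_at_iff
    by (blast intro: nec_pref_imp_pos_pref)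
qed

text \<open>
  The impossibility of \<open>b\<^sup>(\<^sup>i\<^sup>) \<ge> c\<^sup>(\<^sup>k\<^sup>)\<close> makes \<open>c\<^sup>(\<^sup>k\<^sup>) \<ge> b\<^sup>(\<^sup>i\<^sup>)\<close> necessary, so a value function with
  \<open>a\<^sup>(\<^sup>i\<^sup>) \<ge> c\<^sup>(\<^sup>k\<^sup>)\<close> would also have \<open>a\<^sup>(\<^sup>i\<^sup>) \<ge> b\<^sup>(\<^sup>i\<^sup>) \<ge> b\<^sup>(\<^sup>k\<^sup>)\<close>.
\<close>
lemma possible_at_negatively_transitive:
  assumes "valid_problem M" "i \<in> indicators M" "k \<in> indicators M" "k \<le> i"
  shows "negatively_transitive_on (alternatives M) (possible_at M i k)"
  unfolding negatively_transitive_on_def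
proof (intro ballI impI notI, elim conjE)
  fix a b c
  assume abc: "a \<in> alternatives M" "b \<in> alternatives M" "c \<in> alternatives M"
    and ab: "(a, b) \<notin> possible_at M i k" and bc: "(b, c) \<notin> possible_at M i k"
    and ac: "(a, c) \<in> possible_at M i k"
  from abc bc have "nec_pref M (fictitious M c k) (fictitious M b i)"
    unfolding possible_at_iff by (blast intro: not_pos_pref_imp_nec_pref)
  then have "(c, b) \<in> necessary_at M k i"
    using abc by (simp only: necessary_at_iff)
  with ac have "(a, b) \<in> possible_at M i i"
    using assms(1,3) by (blast intro: possible_necessary_at_trans)
  then have "(a, b) \<in> possible_at M i k"
    using assms by (blast intro: possible_at_weaken)
  with ab show False ..
qed

section \<open>The properties of the preference relations\<close>

(* The conjuncts are items 1 to 47, in order, one item per line. *)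
theorem proposition4p1:
  fixes M :: "'a problem"
  assumes "valid_problem M"
    and "\<exists>u\<in>compatible M. \<exists>v\<in>compatible M. u \<noteq> v"
  shows
   "let A = alternatives M; n = num_points M; I = indicators M;
        D = dominance M; D' = dominance_at M;
        N = necessary M; N' = necessary_at M;
        P = possible M; P' = possible_at M
    in
      (\<forall>a\<in>A. \<forall>u\<in>compatible M. \<forall>i\<in>I. \<forall>k\<in>I. i \<ge> k \<longrightarrow> val_at M u a i \<ge> val_at M u a k) \<and>
      (\<forall>a\<in>A. \<forall>u\<in>compatible M. val_at M u a 1 \<le> val M u a \<and> val M u a \<le> val_at M u a n) \<and>
      (N \<subseteq> P) \<and>
      (\<forall>i\<in>I. \<forall>k\<in>I. N' i k \<subseteq> P' i k) \<and>
      (preorder_on A N) \<and>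
      (strongly_complete_on A P \<and> negatively_transitive_on A P) \<and>
      (\<forall>a\<in>A. \<forall>b\<in>A. (a, b) \<in> N \<or> (b, a) \<in> P) \<and>
      (D \<subseteq> N) \<and>
      (\<forall>a\<in>A. \<forall>b\<in>A. \<forall>c\<in>A. (a, b) \<in> N \<and> (b, c) \<in> P \<longrightarrow> (a, c) \<in> P) \<and>
      (\<forall>a\<in>A. \<forall>b\<in>A. \<forall>c\<in>A. (a, b) \<in> P \<and> (b, c) \<in> N \<longrightarrow> (a, c) \<in> P) \<and>
      (\<forall>a\<in>A. \<forall>b\<in>A. \<forall>c\<in>A. (a, b) \<in> D \<and> (b, c) \<in> N \<longrightarrow> (a, c) \<in> N) \<and>
      (\<forall>a\<in>A. \<forall>b\<in>A. \<forall>c\<in>A. (a, b) \<in> N \<and> (b, c) \<in> D \<longrightarrow> (a, c) \<in> N) \<and>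
      (\<forall>a\<in>A. \<forall>b\<in>A. \<forall>c\<in>A. (a, b) \<in> D \<and> (b, c) \<in> P \<longrightarrow> (a, c) \<in> P) \<and>
      (\<forall>a\<in>A. \<forall>b\<in>A. \<forall>c\<in>A. (a, b) \<in> P \<and> (b, c) \<in> D \<longrightarrow> (a, c) \<in> P) \<and>
      (\<forall>i\<in>I. \<forall>k\<in>I. D' i k \<subseteq> N' i k) \<and>
      (\<forall>a\<in>A. \<forall>b\<in>A. \<forall>c\<in>A. \<forall>i\<in>I. \<forall>r\<in>I. r \<ge> i \<and> (a, b) \<in> N' i n \<and> (b, c) \<in> N \<longrightarrow> (a, c) \<in> N' r 1) \<and>
      (\<forall>a\<in>A. \<forall>b\<in>A. \<forall>c\<in>A. \<forall>k\<in>I. \<forall>r\<in>I. r \<le> k \<and> (a, b) \<in> N \<and> (b, c) \<in> N' 1 k \<longrightarrow> (a, c) \<in> N' n r) \<and>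
      (\<forall>a\<in>A. \<forall>b\<in>A. \<forall>c\<in>A. \<forall>i\<in>I. \<forall>r\<in>I. r \<ge> i \<and> (a, b) \<in> P' i n \<and> (b, c) \<in> N \<longrightarrow> (a, c) \<in> P' r 1) \<and>
      (\<forall>a\<in>A. \<forall>b\<in>A. \<forall>c\<in>A. \<forall>k\<in>I. \<forall>r\<in>I. r \<le> k \<and> (a, b) \<in> N \<and> (b, c) \<in> P' 1 k \<longrightarrow> (a, c) \<in> P' n r) \<and>
      (\<forall>a\<in>A. \<forall>b\<in>A. \<forall>c\<in>A. \<forall>i\<in>I. \<forall>r\<in>I. r \<ge> i \<and> (a, b) \<in> N' i n \<and> (b, c) \<in> P \<longrightarrow> (a, c) \<in> P' r 1) \<and>
      (\<forall>a\<in>A. \<forall>b\<in>A. \<forall>c\<in>A. \<forall>k\<in>I. \<forall>r\<in>I. r \<le> k \<and> (a, b) \<in> P \<and> (b, c) \<in> N' 1 k \<longrightarrow> (a, c) \<in> P' n r) \<and>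
      (\<forall>a\<in>A. \<forall>b\<in>A. \<forall>c\<in>A. \<forall>i\<in>I. \<forall>r\<in>I. r \<ge> i \<and> (a, b) \<in> D' i n \<and> (b, c) \<in> N \<longrightarrow> (a, c) \<in> N' r 1) \<and>
      (\<forall>a\<in>A. \<forall>b\<in>A. \<forall>c\<in>A. \<forall>k\<in>I. \<forall>r\<in>I. r \<le> k \<and> (a, b) \<in> N \<and> (b, c) \<in> D' 1 k \<longrightarrow> (a, c) \<in> N' n r) \<and>
      (\<forall>a\<in>A. \<forall>b\<in>A. \<forall>c\<in>A. \<forall>i\<in>I. \<forall>r\<in>I. r \<ge> i \<and> (a, b) \<in> D' i n \<and> (b, c) \<in> P \<longrightarrow> (a, c) \<in> P' r 1) \<and>
      (\<forall>a\<in>A. \<forall>b\<in>A. \<forall>c\<in>A. \<forall>k\<in>I. \<forall>r\<in>I. r \<le> k \<and> (a, b) \<in> P \<and> (b, c) \<in> D' 1 k \<longrightarrow> (a, c) \<in> P' n r) \<and>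
      (\<forall>a\<in>A. \<forall>b\<in>A. \<forall>c\<in>A. \<forall>k\<in>I. \<forall>r\<in>I. r \<le> k \<and> (a, b) \<in> D \<and> (b, c) \<in> N' 1 k \<longrightarrow> (a, c) \<in> N' n r) \<and>
      (\<forall>a\<in>A. \<forall>b\<in>A. \<forall>c\<in>A. \<forall>i\<in>I. \<forall>r\<in>I. r \<ge> i \<and> (a, b) \<in> N' i n \<and> (b, c) \<in> D \<longrightarrow> (a, c) \<in> N' r 1) \<and>
      (\<forall>a\<in>A. \<forall>b\<in>A. \<forall>c\<in>A. \<forall>k\<in>I. \<forall>r\<in>I. r \<le> k \<and> (a, b) \<in> D \<and> (b, c) \<in> P' 1 k \<longrightarrow> (a, c) \<in> P' n r) \<and>
      (\<forall>a\<in>A. \<forall>b\<in>A. \<forall>c\<in>A. \<forall>i\<in>I. \<forall>r\<in>I. r \<ge> i \<and> (a, b) \<in> P' i n \<and> (b, c) \<in> D \<longrightarrow> (a, c) \<in> P' r 1) \<and>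
      (\<forall>i\<in>I. \<forall>k\<in>I. i \<ge> k \<longrightarrow> refl_on A (N' i k)) \<and>
      (\<forall>i\<in>I. \<forall>k\<in>I. i \<le> k \<longrightarrow> trans (N' i k)) \<and>
      (\<forall>i\<in>I. preorder_on A (N' i i)) \<and>
      (\<forall>a\<in>A. \<forall>b\<in>A. \<forall>i\<in>I. \<forall>k\<in>I. (a, b) \<in> N' i k \<or> (b, a) \<in> P' k i) \<and>
      (\<forall>i\<in>I. \<forall>k\<in>I. i \<ge> k \<longrightarrow> strongly_complete_on A (P' i k) \<and> negatively_transitive_on A (P' i k)) \<and>
      (\<forall>i\<in>I. \<forall>k\<in>I. \<forall>i1\<in>I. \<forall>k1\<in>I. i1 \<ge> i \<and> k1 \<le> k \<longrightarrow> N' i k \<subseteq> N' i1 k1) \<and>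
      (\<forall>i\<in>I. \<forall>k\<in>I. \<forall>i1\<in>I. \<forall>k1\<in>I. i1 \<ge> i \<and> k1 \<le> k \<longrightarrow> P' i k \<subseteq> P' i1 k1) \<and>
      (\<forall>i\<in>I. \<forall>k\<in>I. N' 1 n \<subseteq> N' i k \<and> N' i k \<subseteq> N' n 1) \<and>
      (\<forall>i\<in>I. \<forall>k\<in>I. P' 1 n \<subseteq> P' i k \<and> P' i k \<subseteq> P' n 1) \<and>
      (N' 1 n \<subseteq> N \<and> N \<subseteq> N' n 1) \<and>
      (P' 1 n \<subseteq> P \<and> P \<subseteq> P' n 1) \<and>
      (\<forall>a\<in>A. \<forall>b\<in>A. \<forall>c\<in>A. \<forall>i\<in>I. \<forall>k\<in>I. \<forall>i1\<in>I. \<forall>k1\<in>I. \<forall>r\<in>I. \<forall>s\<in>I. k \<ge> i1 \<and> r \<ge> i \<and> s \<le> k1 \<and> (a, b) \<in> N' i k \<and> (b, c) \<in> N' i1 k1 \<longrightarrow> (a, c) \<in> N' r s) \<and>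
      (\<forall>a\<in>A. \<forall>b\<in>A. \<forall>c\<in>A. \<forall>i\<in>I. \<forall>k\<in>I. \<forall>i1\<in>I. \<forall>k1\<in>I. \<forall>r\<in>I. \<forall>s\<in>I. k \<ge> i1 \<and> r \<ge> i \<and> s \<le> k1 \<and> (a, b) \<in> N' i k \<and> (b, c) \<in> P' i1 k1 \<longrightarrow> (a, c) \<in> P' r s) \<and>
      (\<forall>a\<in>A. \<forall>b\<in>A. \<forall>c\<in>A. \<forall>i\<in>I. \<forall>k\<in>I. \<forall>i1\<in>I. \<forall>k1\<in>I. \<forall>r\<in>I. \<forall>s\<in>I. k \<ge> i1 \<and> r \<ge> i \<and> s \<le> k1 \<and> (a, b) \<in> P' i k \<and> (b, c) \<in> N' i1 k1 \<longrightarrow> (a, c) \<in> P' r s) \<and>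
      (\<forall>a\<in>A. \<forall>b\<in>A. \<forall>c\<in>A. \<forall>i\<in>I. \<forall>k\<in>I. \<forall>i1\<in>I. \<forall>k1\<in>I. \<forall>r\<in>I. \<forall>s\<in>I. k \<ge> i1 \<and> r \<ge> i \<and> s \<le> k1 \<and> (a, b) \<in> D' i k \<and> (b, c) \<in> N' i1 k1 \<longrightarrow> (a, c) \<in> N' r s) \<and>
      (\<forall>a\<in>A. \<forall>b\<in>A. \<forall>c\<in>A. \<forall>i\<in>I. \<forall>k\<in>I. \<forall>i1\<in>I. \<forall>k1\<in>I. \<forall>r\<in>I. \<forall>s\<in>I. k \<ge> i1 \<and> r \<ge> i \<and> s \<le> k1 \<and> (a, b) \<in> N' i k \<and> (b, c) \<in> D' i1 k1 \<longrightarrow> (a, c) \<in> N' r s) \<and>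
      (\<forall>a\<in>A. \<forall>b\<in>A. \<forall>c\<in>A. \<forall>i\<in>I. \<forall>k\<in>I. \<forall>i1\<in>I. \<forall>k1\<in>I. \<forall>r\<in>I. \<forall>s\<in>I. k \<ge> i1 \<and> r \<ge> i \<and> s \<le> k1 \<and> (a, b) \<in> D' i k \<and> (b, c) \<in> P' i1 k1 \<longrightarrow> (a, c) \<in> P' r s) \<and>
      (\<forall>a\<in>A. \<forall>b\<in>A. \<forall>c\<in>A. \<forall>i\<in>I. \<forall>k\<in>I. \<forall>i1\<in>I. \<forall>k1\<in>I. \<forall>r\<in>I. \<forall>s\<in>I. k \<ge> i1 \<and> r \<ge> i \<and> s \<le> k1 \<and> (a, b) \<in> P' i k \<and> (b, c) \<in> D' i1 k1 \<longrightarrow> (a, c) \<in> P' r s)"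
proof -
  note valid = assms(1)
  have ne: "compatible M \<noteq> {}"
    using assms(2) by blast
  have ends: "1 \<in> indicators M" "num_points M \<in> indicators M"
    using valid by (auto simp: valid_problem_def)
  have range: "1 \<le> i" "i \<le> num_points M" if "i \<in> indicators M" for i
    using that by auto
  note rels = necessary_iff possible_iff necessary_at_iff possible_at_iff
  note mono = fictitious_mono[OF valid]
    and between = fictitious_first_le[OF valid] fictitious_last_ge[OF valid]
    and N_P = nec_pref_imp_pos_pref[OF ne]
  note dominance = subsetD[OF dominance_subset_necessary[OF valid]]
    and dominance_at = subsetD[OF dominance_at_subset_necessary_at[OF valid]]
    and to_extremes = subsetD[OF necessary_subset_necessary_at[OF valid]]
      subsetD[OF possible_subset_possible_at[OF valid]]
    and weaken = necessary_at_weaken[OF valid] possible_at_weaken[OF valid]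
    and chain_at = necessary_at_trans[OF valid] necessary_possible_at_trans[OF valid]
      possible_necessary_at_trans[OF valid]
  have chain:
    "(a, b) \<in> necessary M \<Longrightarrow> (b, c) \<in> necessary M \<Longrightarrow> (a, c) \<in> necessary M"
    "(a, b) \<in> necessary M \<Longrightarrow> (b, c) \<in> possible M \<Longrightarrow> (a, c) \<in> possible M"
    "(a, b) \<in> possible M \<Longrightarrow> (b, c) \<in> necessary M \<Longrightarrow> (a, c) \<in> possible M" for a b c
    unfolding necessary_iff possible_iff
    by (blast intro: nec_pref_trans nec_pos_trans pos_nec_trans)+
  show ?thesis
    unfolding Let_def
    apply (intro conjI)
    subgoal using mono by (auto simp: nec_pref_def val_at_def)
    subgoal using between by (auto simp: nec_pref_def val_at_def val_def)
    apply (auto simp: rels intro: N_P)[2]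
    subgoal by (auto simp: preorder_on_def refl_on_def trans_def rels
          intro: nec_pref_refl nec_pref_trans)
    subgoal by (auto simp: strongly_complete_on_def rels dest: not_pos_pref_imp_nec_pref intro: N_P)
    subgoal unfolding negatively_transitive_on_def rels
      by (meson pos_nec_trans not_pos_pref_imp_nec_pref)
    subgoal by (auto simp: rels intro: not_nec_pref_imp_pos_pref)
    subgoal using dominance by blast
    (* Mixed chains of real alternatives, with dominance read as necessary preference. *)
    apply ((blast dest: dominance intro: chain)+)[6]
    subgoal using dominance_at by blast
    (* A comparison of b with c is also one of b^(n) with c^(1), so it continues one that ends in
       b^(n); likewise one of a with b ends in b^(1) and is continued by one starting there. *)
    apply ((meson ends to_extremes dominance dominance_at weaken chain_at order_refl)+)[14]
    subgoal by (auto simp: refl_on_def rels intro: mono)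
    subgoal unfolding trans_def by (meson chain_at)
    subgoal by (auto simp: preorder_on_def refl_on_def trans_def rels
          intro: nec_pref_refl nec_pref_trans)
    subgoal by (auto simp: rels intro: not_nec_pref_imp_pos_pref)
    subgoal using possible_at_strongly_complete[OF valid ne]
        possible_at_negatively_transitive[OF valid] by blast
    apply ((intro ballI conjI impI subrelI; meson ends range weaken)+)[4]
    apply (rule necessary_at_subset_necessary[OF valid])
    apply (rule necessary_subset_necessary_at[OF valid])
    apply (rule possible_at_subset_possible[OF valid])
    apply (rule possible_subset_possible_at[OF valid])
    (* First chain at b, then weaken the indicators of a and c to r and s. *)
    apply ((meson dominance_at weaken chain_at)+)[7]
    done
qed

end
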